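(* For $n \ge 2$, let $M(n)$ denote the maximum, over all colorings $c : \{1,\ldots,n\} \to \{1,2,3\}$, of the number of Schur triples in $\{1,\ldots,n\}$ that are rainbow with respect to $c$, and let $N(n) = \binom{n}{2}$ be the total number of Schur triples in $\{1,\ldots,n\}$. Then $$0.4 \;\le\; \liminf_{n \to \infty} \frac{M(n)}{N(n)} \qquad\text{and}\qquad \limsup_{n \to \infty} \frac{M(n)}{N(n)} \;\le\; 0.66364 .$$
   Context: A Schur triple in $\{1,\ldots,n\}$ is an ordered triple $(x,y,z) \in \{1,\ldots,n\}^3$ with $x + y = z$; the case $x = y$ is allowed, and $(x,y,z)$ and $(y,x,z)$ are counted as distinct triples when $x \ne y$. There are exactly $\binom{n}{2}$ such triples. A Schur triple $(x,y,z)$ is rainbow with respect to a coloring $c : \{1,\ldots,n\} \to \{1,2,3\}$ if $c(x)$, $c(y)$, $c(z)$ are pairwise distinct. "The maximum fraction of Schur triples that can be rainbow asymptotically is between $a$ and $b$" means that $M(n)/N(n)$ is at least $a - o(1)$ and at most $b + o(1)$ as $n \to \infty$. *)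

theory Defs
  imports "HOL-Analysis.Analysis"
begin

definition schur_triples :: "nat \<Rightarrow> (nat \<times> nat \<times> nat) set" where
  "schur_triples n = {(x, y, z). x \<in> {1..n} \<and> y \<in> {1..n} \<and> z \<in> {1..n} \<and> x + y = z}"

definition rainbow :: "(nat \<Rightarrow> nat) \<Rightarrow> nat \<times> nat \<times> nat \<Rightarrow> bool" where
  "rainbow c = (\<lambda>(x, y, z). c x \<noteq> c y \<and> c y \<noteq> c z \<and> c x \<noteq> c z)"

(* The extensional function space makes the set of colorings finite, so that Max is a genuine maximum. *)
definition colorings :: "nat \<Rightarrow> (nat \<Rightarrow> nat) set" where
  "colorings n = {1..n} \<rightarrow>\<^sub>E {1, 2, 3}"

definition max_rainbow :: "nat \<Rightarrow> nat" where
  "max_rainbow n = Max ((\<lambda>c. card {t \<in> schur_triples n. rainbow c t}) ` colorings n)"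

lemma finite_colorings: "finite (colorings n)"
  unfolding colorings_def by (intro finite_PiE) auto

lemma colorings_nonempty: "colorings n \<noteq> {}"
  unfolding colorings_def by (simp add: PiE_eq_empty_iff)

lemma schur_triples_eq:
  "schur_triples n = (\<lambda>(z, x). (x, z - x, z)) ` (SIGMA z:{..<Suc n}. {1..<z})"
  unfolding schur_triples_def by (auto simp: image_iff)

lemma card_schur_triples: "card (schur_triples n) = n choose 2"
proof -
  have "inj_on (\<lambda>(z, x). (x, z - x, z)) (SIGMA z:{..<Suc n}. {1..<z})"
    by (auto simp: inj_on_def)
  then have "card (schur_triples n) = (\<Sum>z<Suc n. z - 1)"
    unfolding schur_triples_eq by (simp add: card_image)
  also have "\<dots> = n choose 2"
  proof (induction n)
    case (Suc n)
    then show ?case by (simp add: numeral_2_eq_2)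
  qed simp
  finally show ?thesis .
qed

end

theory Submission
  imports Defs "HOL-Real_Asymp.Real_Asymp"
begin

text \<open>
  \<^bold>\<open>Upper bound.\<close> Let \<open>R\<close> be the number of rainbow Schur triples and \<open>B\<close> the number of those that
  show exactly two colors. A Schur triple \<open>(x, y, z)\<close> is determined by \<open>(x, z)\<close>, and also by \<open>(y, z)\<close>.
  A rainbow triple makes both of these pairs bichromatic and a two-colored triple makes at least one of
  them bichromatic, so \<open>2 R + B\<close> is at most the number of ordered bichromatic pairs, hence at most
  \<open>2 n\<^sup>2 / 3\<close> (\<open>rainbow_and_two_colored_le\<close>). With \<open>B \<ge> 0\<close> this gives density \<open>2 / 3\<close>; the stated
  bound needs in addition that \<open>B\<close> is not too small.

  If \<open>B\<close> were negligible, then almost every Schur triple would be monochromatic or rainbow, which over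
  the integers modulo 3 says \<open>c (x + y) = - c x - c y\<close>. This operation is not associative: the two
  ways to evaluate \<open>c (x + y + z)\<close> give \<open>c x + c y - c z\<close> and \<open>- c x + c y + c z\<close>, which differ
  unless \<open>c x = c z\<close>. So every sum \<open>x + y + z \<le> n\<close> with \<open>c x \<noteq> c z\<close> yields a two-colored triple
  (\<open>two_colored_of_associativity\<close>), and no triple is obtained more than \<open>4 n\<close> times
  (\<open>card_bichromatic_sums_le\<close>). Conversely there are many such sums as soon as there are many rainbow
  triples, since a rainbow triple \<open>(x, z, x + z)\<close> supplies the pair with \<open>c x \<noteq> c z\<close>, and all but few
  of these leave room for a middle summand \<open>y\<close> (\<open>card_bichromatic_sums_ge\<close>). Together:
  \<open>k (R - k n) \<le> 4 n B \<le> 4 n (2 n\<^sup>2 / 3 - 2 R)\<close> for every \<open>k\<close>, and \<open>k = n / 6\<close> gives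
  \<open>R \<le> (97 / 294 + o(1)) n\<^sup>2\<close>, a density below \<open>0.66\<close>.

  \<^bold>\<open>Lower bound.\<close> Give one color to the even numbers and split the odd ones at \<open>0.4 n\<close>. Every two odd
  numbers of different color form a rainbow triple with their difference, and one with their sum if
  this is at most \<open>n\<close>. The split at \<open>0.4 n\<close> is the best split of the odd numbers into two intervals.
\<close>

section \<open>Rainbow and two-colored triples\<close>

text \<open>
  For colors in \<open>{1, 2, 3}\<close>, a triple has color sum divisible by 3 exactly if it is monochromatic or
  rainbow. Thus the property below means that exactly two colors occur, in the form that
  allows arithmetic modulo 3.
\<close>

definition two_colored :: "(nat \<Rightarrow> nat) \<Rightarrow> nat \<times> nat \<times> nat \<Rightarrow> bool" where
  "two_colored c = (\<lambda>(x, y, z). \<not> 3 dvd c x + c y + c z)"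

lemma finite_schur_triples: "finite (schur_triples n)"
  by (rule finite_subset[of _ "{1..n} \<times> {1..n} \<times> {1..n}"]) (auto simp: schur_triples_def)

text \<open>
  The monochromatic pairs number \<open>a\<^sup>2 + b\<^sup>2 + d\<^sup>2\<close> for color classes of sizes \<open>a\<close>, \<open>b\<close>, \<open>d\<close>, which is
  least when the classes are equal.
\<close>

lemma card_bichromatic_pairs_le:
  fixes c :: "'a \<Rightarrow> nat"
  assumes fin: "finite A" and c: "c ` A \<subseteq> {1, 2, 3}"
  shows "3 * card {(x, z) \<in> A \<times> A. c x \<noteq> c z} \<le> 2 * (card A)\<^sup>2"
proof -
  define K where "K i = {x \<in> A. c x = i}" for i
  let ?P = "{(x, z) \<in> A \<times> A. c x \<noteq> c z}"
  have finK: "finite (K i)" for i unfolding K_def using fin by simp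
  have "A = (\<Union>i\<in>{1,2,3}. K i)" using c by (auto simp: K_def)
  then have "card A = card (\<Union>i\<in>{1,2,3}. K i)" by simp
  also have "\<dots> = (\<Sum>i\<in>{1,2,3}. card (K i))"
    by (rule card_UN_disjoint) (auto simp: finK, auto simp: K_def)
  finally have A: "card A = card (K 1) + card (K 2) + card (K 3)" by simp
  have "A \<times> A = ?P \<union> (\<Union>i\<in>{1,2,3}. K i \<times> K i)" using c by (auto simp: K_def)
  then have "(card A)\<^sup>2 = card (?P \<union> (\<Union>i\<in>{1,2,3}. K i \<times> K i))"
    by (metis card_cartesian_product power2_eq_square)
  also have "\<dots> = card ?P + card (\<Union>i\<in>{1,2,3}. K i \<times> K i)"
    by (rule card_Un_disjoint)
       (auto simp: finK K_def intro: finite_subset[OF _ finite_cartesian_product[OF fin fin]])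
  also have "card (\<Union>i\<in>{1,2,3}. K i \<times> K i) = (\<Sum>i\<in>{1,2,3}. card (K i \<times> K i))"
    by (rule card_UN_disjoint) (auto simp: finK, auto simp: K_def)
  finally have "(card A)\<^sup>2 = card ?P + ((card (K 1))\<^sup>2 + (card (K 2))\<^sup>2 + (card (K 3))\<^sup>2)"
    by (simp add: card_cartesian_product power2_eq_square)
  moreover have "(card A)\<^sup>2 \<le> 3 * ((card (K 1))\<^sup>2 + (card (K 2))\<^sup>2 + (card (K 3))\<^sup>2)"
  proof -
    have "(a + b + d)\<^sup>2 \<le> 3 * (a\<^sup>2 + b\<^sup>2 + d\<^sup>2)" for a b d :: int
    proof -
      have "3 * (a\<^sup>2 + b\<^sup>2 + d\<^sup>2) - (a + b + d)\<^sup>2 = (a - b)\<^sup>2 + (b - d)\<^sup>2 + (a - d)\<^sup>2"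
        by (simp add: power2_eq_square algebra_simps)
      then show ?thesis by (smt (verit) zero_le_power2)
    qed
    from this[of "int (card (K 1))" "int (card (K 2))" "int (card (K 3))"]
    have "int ((card A)\<^sup>2) \<le> int (3 * ((card (K 1))\<^sup>2 + (card (K 2))\<^sup>2 + (card (K 3))\<^sup>2))"
      unfolding A by simp
    then show ?thesis by (simp only: of_nat_le_iff)
  qed
  moreover have "3 * p \<le> 2 * a" if "a = p + s" "a \<le> 3 * s" for p a s :: nat
    using that by linarith
  ultimately show ?thesis by blast
qed

text \<open>
  Let \<open>X\<close> and \<open>Y\<close> be the sets of triples \<open>(x, y, z)\<close> in which \<open>z\<close> differs in color from \<open>x\<close> and from
  \<open>y\<close>, respectively. Rainbow triples lie in both and two-colored triples in at least one, so the claim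
  follows by counting \<open>X\<close> through the increasing pairs \<open>(x, z)\<close> and \<open>Y\<close> through the
  decreasing pairs \<open>(z, y)\<close>.
\<close>

lemma rainbow_and_two_colored_le:
  assumes c: "c ` {1..n} \<subseteq> {1, 2, 3}"
  shows "3 * (2 * card {t \<in> schur_triples n. rainbow c t}
              + card {t \<in> schur_triples n. two_colored c t}) \<le> 2 * n\<^sup>2"
proof -
  let ?S = "schur_triples n"
  let ?R = "{t \<in> ?S. rainbow c t}" and ?B = "{t \<in> ?S. two_colored c t}"
  let ?P = "{(x, z) \<in> {1..n} \<times> {1..n}. c x \<noteq> c z}"
  define X where "X = {(x, y, z) \<in> ?S. c x \<noteq> c z}"
  define Y where "Y = {(x, y, z) \<in> ?S. c y \<noteq> c z}"
  define f where "f = (\<lambda>(x::nat, y::nat, z::nat). (x, z))"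
  define g where "g = (\<lambda>(x::nat, y::nat, z::nat). (z, y))"
  have finS: "finite ?S" by (rule finite_schur_triples)
  have finXY: "finite X" "finite Y"
    by (rule finite_subset[OF _ finS]; auto simp: X_def Y_def)+
  have cs: "c x = 1 \<or> c x = 2 \<or> c x = 3" if "1 \<le> x" "x \<le> n" for x
    using c that by (force simp: image_subset_iff)
  have "card ?R \<le> card (X \<inter> Y)"
    by (rule card_mono) (auto simp: finXY, auto simp: X_def Y_def rainbow_def)
  moreover have "card ?R + card ?B \<le> card (X \<union> Y)"
  proof -
    have "\<not> two_colored c t" if "t \<in> ?S" "rainbow c t" for t
    proof -
      obtain x y z where t: "t = (x, y, z)" by (cases t)
      show ?thesis using that cs[of x] cs[of y] cs[of z]
        by (auto simp: t schur_triples_def rainbow_def two_colored_def)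
    qed
    then have "card ?R + card ?B = card (?R \<union> ?B)"
      by (intro card_Un_disjoint[symmetric]) (auto simp: finS)
    also have "\<dots> \<le> card (X \<union> Y)"
    proof (rule card_mono)
      have "3 dvd i + i + i" for i :: nat by presburger
      then show "?R \<union> ?B \<subseteq> X \<union> Y"
        by (auto simp: X_def Y_def rainbow_def two_colored_def)
    qed (use finXY in auto)
    finally show ?thesis .
  qed
  ultimately have "2 * card ?R + card ?B \<le> card X + card Y"
    using card_Un_Int[OF finXY] by linarith
  also have "\<dots> = card (f ` X) + card (g ` Y)"
    by (intro arg_cong2[of _ _ _ _ "(+)"] card_image[symmetric])
       (auto simp: inj_on_def X_def Y_def f_def g_def schur_triples_def)
  also have "\<dots> = card (f ` X \<union> g ` Y)"
    by (intro card_Un_disjoint[symmetric])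
       (auto simp: finXY, auto simp: X_def Y_def f_def g_def schur_triples_def)
  also have "\<dots> \<le> card ?P"
    by (intro card_mono finite_subset[of ?P "{1..n} \<times> {1..n}"])
       (auto simp: X_def Y_def f_def g_def schur_triples_def)
  finally show ?thesis
    using card_bichromatic_pairs_le[OF _ c] by simp
qed

section \<open>Two-colored triples forced by associativity\<close>

text \<open>
  If all four color sums vanish modulo 3, then subtracting the third from the first gives
  \<open>c (x + y + z) = c x + c y - c z\<close> and subtracting the second from the fourth gives
  \<open>c (x + y + z) = c y + c z - c x\<close>. Hence \<open>2 c x = 2 c z\<close>, and colors in \<open>{1, 2, 3}\<close> that agree modulo 3
  are equal.
\<close>

lemma two_colored_of_associativity:
  assumes "c x \<in> {1, 2, 3}" "c z \<in> {1, 2, 3}" "c x \<noteq> c z"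
  shows "two_colored c (x, y, x + y) \<or> two_colored c (y, z, y + z) \<or>
         two_colored c (x + y, z, x + y + z) \<or> two_colored c (x, y + z, x + y + z)"
proof (rule ccontr)
  assume "\<not> ?thesis"
  then have d: "3 dvd c x + c y + c (x + y)" "3 dvd c y + c z + c (y + z)"
    "3 dvd c (x + y) + c z + c (x + y + z)" "3 dvd c x + c (y + z) + c (x + y + z)"
    by (auto simp: two_colored_def)
  have "c x mod 3 = c z mod 3"
    using d by presburger
  with assms show False by auto
qed

definition bichromatic_sums :: "nat \<Rightarrow> (nat \<Rightarrow> nat) \<Rightarrow> (nat \<times> nat \<times> nat) set" where
  "bichromatic_sums n c =
     {(x, y, z). 1 \<le> x \<and> 1 \<le> y \<and> 1 \<le> z \<and> x + y + z \<le> n \<and> c x \<noteq> c z}"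

lemma finite_bichromatic_sums: "finite (bichromatic_sums n c)"
  by (rule finite_subset[of _ "{1..n} \<times> {1..n} \<times> {1..n}"]) (auto simp: bichromatic_sums_def)

text \<open>
  Each of the four triples attached to \<open>(x, y, z)\<close>, together with one of the summands \<open>x\<close>, \<open>z\<close>, determines
  \<open>(x, y, z)\<close>. So in each of the four positions a given two-colored triple occurs at most \<open>n\<close> times.
\<close>

lemma card_bichromatic_sums_le:
  assumes c: "c ` {1..n} \<subseteq> {1, 2, 3}"
  shows "card (bichromatic_sums n c) \<le> 4 * n * card {t \<in> schur_triples n. two_colored c t}"
proof -
  let ?Q = "bichromatic_sums n c"
  let ?B = "{t \<in> schur_triples n. two_colored c t}"
  have finB: "finite ?B" by (simp add: finite_schur_triples)
  have bound: "card {q \<in> ?Q. two_colored c (fst (h q))} \<le> n * card ?B"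
    if inj: "inj_on h ?Q" and im: "\<And>q. q \<in> ?Q \<Longrightarrow> h q \<in> schur_triples n \<times> {1..n}"
    for h :: "nat \<times> nat \<times> nat \<Rightarrow> (nat \<times> nat \<times> nat) \<times> nat"
  proof -
    have "card {q \<in> ?Q. two_colored c (fst (h q))} \<le> card (?B \<times> {1..n})"
    proof (rule card_inj_on_le)
      show "inj_on h {q \<in> ?Q. two_colored c (fst (h q))}"
        using inj by (rule inj_on_subset) auto
      show "h ` {q \<in> ?Q. two_colored c (fst (h q))} \<subseteq> ?B \<times> {1..n}"
        using im by fastforce
    qed (use finB in auto)
    then show ?thesis by (simp add: card_cartesian_product mult.commute)
  qed
  \<comment> \<open>The attached triple, followed by the summand that makes the map injective.\<close>
  define h1 where "h1 = (\<lambda>(x::nat, y::nat, z::nat). ((x, y, x + y), z))"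
  define h2 where "h2 = (\<lambda>(x::nat, y::nat, z::nat). ((y, z, y + z), x))"
  define h3 where "h3 = (\<lambda>(x::nat, y::nat, z::nat). ((x + y, z, x + y + z), x))"
  define h4 where "h4 = (\<lambda>(x::nat, y::nat, z::nat). ((x, y + z, x + y + z), z))"
  let ?Qh = "\<lambda>h. {q \<in> ?Q. two_colored c (fst (h q))}"
  have "?Q \<subseteq> ?Qh h1 \<union> ?Qh h2 \<union> (?Qh h3 \<union> ?Qh h4)"
  proof
    fix q assume q: "q \<in> ?Q"
    obtain x y z where xyz: "q = (x, y, z)" by (cases q)
    have "x \<in> {1..n}" "z \<in> {1..n}" "c x \<noteq> c z"
      using q by (auto simp: xyz bichromatic_sums_def)
    then have "c x \<in> {1, 2, 3}" "c z \<in> {1, 2, 3}" "c x \<noteq> c z"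
      using c by blast+
    from two_colored_of_associativity[of c x z y, OF this] q
    show "q \<in> ?Qh h1 \<union> ?Qh h2 \<union> (?Qh h3 \<union> ?Qh h4)"
      by (auto simp: xyz h1_def h2_def h3_def h4_def)
  qed
  then have "card ?Q \<le> card (?Qh h1 \<union> ?Qh h2 \<union> (?Qh h3 \<union> ?Qh h4))"
    by (rule card_mono[rotated]) (simp add: finite_bichromatic_sums)
  also have "\<dots> \<le> (card (?Qh h1) + card (?Qh h2)) + (card (?Qh h3) + card (?Qh h4))"
    by (meson add_mono card_Un_le order_trans)
  also have "\<dots> \<le> (n * card ?B + n * card ?B) + (n * card ?B + n * card ?B)"
    by (intro add_mono bound)
       (auto simp: inj_on_def h1_def h2_def h3_def h4_def bichromatic_sums_def schur_triples_def)
  finally show ?thesis by simp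
qed

text \<open>
  A rainbow triple \<open>(x, z, x + z)\<close> with \<open>x + z + k \<le> n\<close> accepts each of \<open>1, \<dots>, k\<close> as the middle
  summand \<open>y\<close>. The sum of any other Schur triple takes one of \<open>k\<close> values, which leaves at
  most \<open>k n\<close> of them.
\<close>

lemma card_bichromatic_sums_ge:
  "k * card {t \<in> schur_triples n. rainbow c t} \<le> card (bichromatic_sums n c) + k * (k * n)"
proof -
  let ?R = "{t \<in> schur_triples n. rainbow c t}"
  define G where "G = {(x, y, z) \<in> ?R. z + k \<le> n}"
  define L where "L = {(x, y, z) \<in> ?R. n < z + k}"
  have fin: "finite G" "finite L"
    by (rule finite_subset[OF _ finite_schur_triples[of n]]; auto simp: G_def L_def)+
  have "card L \<le> card ({n - k<..n} \<times> {1..n})"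
    by (rule card_inj_on_le[of "\<lambda>(x, y, z). (z, x)"])
       (auto simp: inj_on_def L_def schur_triples_def)
  also have "\<dots> = (n - (n - k)) * n" by (simp add: card_cartesian_product)
  also have "\<dots> \<le> k * n" by (rule mult_le_mono1) simp
  finally have L: "card L \<le> k * n" .
  have "card (G \<times> {1..k}) \<le> card (bichromatic_sums n c)"
    by (rule card_inj_on_le[of "\<lambda>((x, y, z), j). (x, j, y)"])
       (auto simp: finite_bichromatic_sums, 
        auto simp: inj_on_def G_def schur_triples_def rainbow_def bichromatic_sums_def)
  then have G: "k * card G \<le> card (bichromatic_sums n c)"
    by (simp add: card_cartesian_product mult.commute)
  have "?R = G \<union> L" by (auto simp: G_def L_def)
  then have "card ?R \<le> card G + card L" by (metis card_Un_le)
  then have "k * card ?R \<le> k * card G + k * card L" by (metis distrib_left mult_le_mono2)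
  with L G show ?thesis by (meson add_mono le_trans mult_le_mono2)
qed

section \<open>The upper bound\<close>

lemma real_choose_two: "real (n choose 2) = real n * (real n - 1) / 2"
  by (cases n) (simp_all add: choose_two real_of_nat_div algebra_simps)

text \<open>
  The two inequalities between \<open>R\<close> and \<open>B\<close> are combined by eliminating \<open>B\<close>. The value \<open>k = n div 6\<close> is
  close to the optimal one, and \<open>300\<close> is large enough to absorb the lower order terms that come from
  rounding \<open>n / 6\<close> and from \<open>n choose 2\<close> in place of \<open>n\<^sup>2 / 2\<close>.
\<close>

lemma card_rainbow_le:
  assumes c: "c ` {1..n} \<subseteq> {1, 2, 3}" and n: "n \<ge> 300"
  shows "real (card {t \<in> schur_triples n. rainbow c t}) \<le> 0.66364 * real (n choose 2)"
proof -
  define R where "R = real (card {t \<in> schur_triples n. rainbow c t})"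
  define B where "B = real (card {t \<in> schur_triples n. two_colored c t})"
  define k where "k = real (n div 6)"
  define N where "N = real n"
  have N: "N \<ge> 300" using n by (simp add: N_def)
  have k: "k \<le> N / 6" "N / 6 - 1 \<le> k" unfolding k_def N_def by linarith+
  have "real (3 * (2 * card {t \<in> schur_triples n. rainbow c t}
              + card {t \<in> schur_triples n. two_colored c t})) \<le> real (2 * n\<^sup>2)"
    using rainbow_and_two_colored_le[OF c] by (rule of_nat_mono)
  then have 1: "3 * (2 * R + B) \<le> 2 * N\<^sup>2" by (simp add: R_def B_def N_def)
  have "n div 6 * card {t \<in> schur_triples n. rainbow c t} \<le>
      4 * n * card {t \<in> schur_triples n. two_colored c t} + n div 6 * (n div 6 * n)"
    using card_bichromatic_sums_ge[of "n div 6" n c] card_bichromatic_sums_le[OF c] by linarith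
  then have "real (n div 6 * card {t \<in> schur_triples n. rainbow c t}) \<le>
      real (4 * n * card {t \<in> schur_triples n. two_colored c t} + n div 6 * (n div 6 * n))"
    by (rule of_nat_mono)
  then have 2: "k * R \<le> 4 * N * B + k * (k * N)"
    by (simp add: R_def B_def N_def k_def)
  have choose: "real (n choose 2) = N * (N - 1) / 2"
    by (simp add: real_choose_two N_def)
  show ?thesis
  proof (rule ccontr)
    assume "\<not> ?thesis"
    then have R: "R > 0.33182 * (N * (N - 1))" by (simp add: choose flip: R_def)
    \<comment> \<open>A crude quadratic bound, to have \<open>R\<close> above \<open>k N\<close>, so that \<open>k\<close> may be replaced by \<open>N / 6 - 1\<close>.\<close>
    have "N * (0.99 * N) \<le> N * (N - 1)" using N by (intro mult_left_mono) auto
    then have N2: "0.99 * (N * N) \<le> N * (N - 1)" by (simp only: mult.left_commute)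
    have "a / 6 \<le> R" if "0.33182 * b < R" "0.99 * a \<le> b" "0 \<le> a" for a b
      using that by simp
    from this[OF R N2 zero_le_square] have R2: "N / 6 * N \<le> R" by simp
    have kN: "k * N \<le> N / 6 * N" using k N by (intro mult_right_mono) auto
    have "(N / 6 - 1) * (R - N / 6 * N) \<le> k * (R - k * N)"
      using k kN R2 N by (intro mult_mono) auto
    also have "\<dots> \<le> 4 * N * B" using 2 by (simp add: algebra_simps)
    also have "\<dots> \<le> 4 * N * (2 * N\<^sup>2 / 3 - 2 * R)"
      using 1 N by (intro mult_left_mono) auto
    finally have "R * (49 / 6 * N - 1) \<le> (97 / 36 * N - 1 / 6) * N\<^sup>2"
      by (simp add: field_simps power2_eq_square)
    moreover have "0.33182 * (N * (N - 1)) * (49 / 6 * N - 1) \<le> R * (49 / 6 * N - 1)"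
      using R N by (intro mult_right_mono) auto
    ultimately have "0.33182 * (N * (N - 1)) * (49 / 6 * N - 1) \<le> (97 / 36 * N - 1 / 6) * N\<^sup>2"
      by (rule order_trans[rotated])
    then have "N * (0.33182 * (N - 1) * (49 / 6 * N - 1)) \<le> N * ((97 / 36 * N - 1 / 6) * N)"
      by (simp only: power2_eq_square mult_ac)
    then have "0.33182 * (N - 1) * (49 / 6 * N - 1) \<le> (97 / 36 * N - 1 / 6) * N"
      using N by simp
    \<comment> \<open>The difference of the two sides after clearing denominators, without its constant term.\<close>
    then have "N * (N * 166524) \<le> N * 31050180" by (simp add: field_simps)
    then have "N * 166524 \<le> 31050180" using N by simp
    then show False using N by simp
  qed
qed

lemma max_rainbow_attained:
  obtains c where "c ` {1..n} \<subseteq> {1, 2, 3}"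
    and "max_rainbow n = card {t \<in> schur_triples n. rainbow c t}"
proof -
  have "max_rainbow n \<in> (\<lambda>c. card {t \<in> schur_triples n. rainbow c t}) ` colorings n"
    unfolding max_rainbow_def
    by (intro Max_in) (auto simp: finite_colorings colorings_nonempty)
  then obtain c where "c \<in> colorings n"
    "max_rainbow n = card {t \<in> schur_triples n. rainbow c t}" by auto
  then show ?thesis by (intro that[of c]) (auto simp: colorings_def PiE_iff)
qed

text \<open>Membership in \<open>colorings n\<close> fixes the values outside \<open>{1..n}\<close>, which no Schur triple sees.\<close>

lemma max_rainbow_ge:
  assumes "c ` {1..n} \<subseteq> {1, 2, 3}"
  shows "card {t \<in> schur_triples n. rainbow c t} \<le> max_rainbow n"
proof -
  have "restrict c {1..n} \<in> colorings n"
    using assms by (auto simp: colorings_def)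
  moreover have "{t \<in> schur_triples n. rainbow (restrict c {1..n}) t} =
      {t \<in> schur_triples n. rainbow c t}"
    by (auto simp: schur_triples_def rainbow_def)
  ultimately show ?thesis
    unfolding max_rainbow_def by (intro Max_ge) (auto simp: finite_colorings image_iff intro: bexI[of _ "restrict c {1..n}"])
qed

section \<open>The lower bound\<close>

text \<open>The parameter \<open>m\<close> stands for \<open>n / 10\<close>, so that \<open>4 * m\<close> is the split point \<open>0.4 n\<close>.\<close>

definition split_odds :: "nat \<Rightarrow> nat \<Rightarrow> nat" where
  "split_odds m x = (if even x then 3 else if x < 4 * m then 1 else 2)"

lemma sum_decreasing_le:
  fixes k N :: nat
  assumes "k \<le> N"
  shows "2 * (\<Sum>i<k. N - i) + k * k = k * (2 * N + 1)"
  using assms by (induction k) (auto simp: algebra_simps)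

text \<open>
  Consider an odd number \<open>2 i + 1 < 4 m\<close> and an odd number \<open>2 j + 1\<close> between \<open>4 m\<close> and \<open>10 m\<close>. All
  \<open>2 m \<cdot> 3 m\<close> such pairs form a rainbow triple with the difference, and at least \<open>4 m\<^sup>2\<close> of them
  form one with the sum, namely those with \<open>i + j < 5 m\<close>. Exchanging the first two entries doubles both
  counts.
\<close>

lemma card_rainbow_split_odds:
  assumes m: "10 * m \<le> n"
  shows "20 * m\<^sup>2 \<le> card {t \<in> schur_triples n. rainbow (split_odds m) t}"
proof -
  let ?R = "{t \<in> schur_triples n. rainbow (split_odds m) t}"
  define I where "I = (SIGMA i:{..<2 * m}. {2 * m..<5 * m - i})"
  define J where "J = {..<2 * m} \<times> {2 * m..<5 * m}"
  define f where "f = (\<lambda>(i::nat, j::nat). (2 * i + 1, 2 * j + 1, 2 * i + 2 * j + 2))"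
  define f' where "f' = (\<lambda>(i::nat, j::nat). (2 * j + 1, 2 * i + 1, 2 * i + 2 * j + 2))"
  define g where "g = (\<lambda>(i::nat, j::nat). (2 * i + 1, 2 * (j - i), 2 * j + 1))"
  define g' where "g' = (\<lambda>(i::nat, j::nat). (2 * (j - i), 2 * i + 1, 2 * j + 1))"
  have fin: "finite I" "finite J" by (simp_all add: I_def J_def)
  have "card I = (\<Sum>i<2 * m. 3 * m - i)"
    by (simp add: I_def)
  with sum_decreasing_le[of "2 * m" "3 * m"] have I: "4 * m\<^sup>2 \<le> card I"
    by (simp add: algebra_simps power2_eq_square)
  have J: "card J = 6 * m\<^sup>2"
    by (simp add: J_def card_cartesian_product power2_eq_square)
  have inj: "card (f ` I) = card I" "card (f' ` I) = card I"
    "card (g ` J) = card J" "card (g' ` J) = card J"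
    by (intro card_image; auto simp: inj_on_def f_def f'_def g_def g'_def J_def)+
  have par: "2 * a + 1 \<noteq> 2 * (b - d)" "2 * (b - d) \<noteq> 2 * a + 1" 
    "Suc (2 * a) \<noteq> 2 * (b - d)" "2 * (b - d) \<noteq> Suc (2 * a)" for a b d :: nat
    by presburger+
  have "card (f ` I \<union> f' ` I) = card (f ` I) + card (f' ` I)"
    by (intro card_Un_disjoint) (use fin in \<open>auto simp: f_def f'_def I_def\<close>)
  moreover have "card (g ` J \<union> g' ` J) = card (g ` J) + card (g' ` J)"
    by (intro card_Un_disjoint) (use fin in \<open>auto simp: g_def g'_def J_def par\<close>)
  moreover have "card ((f ` I \<union> f' ` I) \<union> (g ` J \<union> g' ` J)) =
      card (f ` I \<union> f' ` I) + card (g ` J \<union> g' ` J)"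
    by (intro card_Un_disjoint) (auto simp: fin f_def f'_def g_def g'_def par)
  moreover have "(f ` I \<union> f' ` I) \<union> (g ` J \<union> g' ` J) \<subseteq> ?R"
    using m by (auto simp: f_def f'_def g_def g'_def I_def J_def schur_triples_def
        rainbow_def split_odds_def)
  then have "card ((f ` I \<union> f' ` I) \<union> (g ` J \<union> g' ` J)) \<le> card ?R"
    by (rule card_mono[rotated]) (simp add: finite_schur_triples)
  ultimately show ?thesis using I J inj by linarith
qed

theorem theorem1p1:
  shows "ereal 0.4 \<le> liminf (\<lambda>n. ereal (real (max_rainbow n) / real (n choose 2)))
       \<and> limsup (\<lambda>n. ereal (real (max_rainbow n) / real (n choose 2))) \<le> ereal 0.66364"
proof
  let ?q = "\<lambda>n. real (max_rainbow n) / real (n choose 2)"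
  have low: "0.4 * (1 - 10 / real n)\<^sup>2 \<le> ?q n" if n: "n \<ge> 10" for n
  proof -
    define m where "m = n div 10"
    have m: "real n / 10 - 1 \<le> real m" unfolding m_def by linarith
    have "20 * m\<^sup>2 \<le> card {t \<in> schur_triples n. rainbow (split_odds m) t}"
      by (rule card_rainbow_split_odds) (simp add: m_def)
    also have "\<dots> \<le> max_rainbow n"
      by (rule max_rainbow_ge) (auto simp: split_odds_def)
    finally have "real (20 * m\<^sup>2) \<le> real (max_rainbow n)" by (rule of_nat_mono)
    moreover have "(real n / 10 - 1)\<^sup>2 \<le> (real m)\<^sup>2"
      using m n by (intro power_mono) auto
    ultimately have M: "20 * (real n / 10 - 1)\<^sup>2 \<le> real (max_rainbow n)" by simp
    have pos: "0 < real (n choose 2)" using n by simp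
    have C: "real (n choose 2) \<le> (real n)\<^sup>2 / 2"
      by (simp add: real_choose_two power2_eq_square mult_left_mono)
    have "0.4 * (1 - 10 / real n)\<^sup>2 = 20 * (real n / 10 - 1)\<^sup>2 / ((real n)\<^sup>2 / 2)"
      using n by (simp add: field_simps power2_eq_square)
    also have "\<dots> \<le> ?q n"
      using M C pos by (intro frac_le) auto
    finally show ?thesis .
  qed
  have "(\<lambda>n. 0.4 * (1 - 10 / real n)\<^sup>2) \<longlonglongrightarrow> 0.4"
    by real_asymp
  then have "liminf (\<lambda>n. ereal (0.4 * (1 - 10 / real n)\<^sup>2)) = ereal 0.4"
    by (intro lim_imp_Liminf) (auto simp: tendsto_ereal)
  moreover have "liminf (\<lambda>n. ereal (0.4 * (1 - 10 / real n)\<^sup>2)) \<le> liminf (\<lambda>n. ereal (?q n))"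
    by (intro Liminf_mono eventually_sequentiallyI[of 10]) (simp only: ereal_less_eq low)
  ultimately show "ereal 0.4 \<le> liminf (\<lambda>n. ereal (?q n))" by simp
  have "?q n \<le> 0.66364" if n: "n \<ge> 300" for n
  proof -
    obtain c where "c ` {1..n} \<subseteq> {1, 2, 3}"
      and "max_rainbow n = card {t \<in> schur_triples n. rainbow c t}"
      by (rule max_rainbow_attained)
    with card_rainbow_le n have "real (max_rainbow n) \<le> 0.66364 * real (n choose 2)" by simp
    moreover have "0 < real (n choose 2)" using n by simp
    ultimately show ?thesis by (simp only: pos_divide_le_eq)
  qed
  then show "limsup (\<lambda>n. ereal (?q n)) \<le> ereal 0.66364"
    by (intro Limsup_bounded eventually_sequentiallyI[of 300]) (simp only: ereal_less_eq)
qed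

end
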